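(* For every integer $n\geq 6$, $$g(n)\leq \frac{9.78^n}{500},$$ where $g(n)$ is the minimum number of peeling sequences of an $n$-point set in general position in $\mathbb{R}^2$.
   Context: A finite set $P\subset\mathbb{R}^2$ is in general position if no three of its points are collinear. A peeling sequence of $P$ is an ordering $p_1,\dots,p_{|P|}$ of all points of $P$ such that for every $i$, the point $p_i$ is a vertex of the convex hull of $P\setminus\{p_1,\dots,p_{i-1}\}$ (i.e. points are removed one at a time, each time from the convex hull of the remaining set). Let $g(P)$ be the number of peeling sequences of $P$, and $g(n)=\min_{|P|=n} g(P)$, the minimum over all $n$-point sets $P$ in general position in $\mathbb{R}^2$. *)

theory Defs
  imports "HOL-Analysis.Analysis" "HOL-Combinatorics.Multiset_Permutations"
begin

definition general_position :: "(real^2) set \<Rightarrow> bool" where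
  "general_position P \<longleftrightarrow> (\<forall>S\<subseteq>P. card S = 3 \<longrightarrow> \<not> collinear S)"

(* Lists are indexed from 0, so set (take i ps) is the set of points removed before step i.
   A vertex of the convex polygon spanned by finitely many points is an extreme point. *)
definition peeling_sequences :: "(real^2) set \<Rightarrow> (real^2) list set" where
  "peeling_sequences P =
     {ps \<in> permutations_of_set P.
        \<forall>i<length ps. (ps ! i) extreme_point_of (convex hull (P - set (take i ps)))}"

definition num_peelings :: "(real^2) set \<Rightarrow> nat" where
  "num_peelings P = card (peeling_sequences P)"

(* Min would be unspecified if the set of values were infinite; Inf on nat is the least element
   of any nonempty set. Lemma min_peelings_attained shows that it really is a minimum. *)
definition min_peelings :: "nat \<Rightarrow> nat" where
  "min_peelings n = Inf (num_peelings ` {P. finite P \<and> card P = n \<and> general_position P})"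

lemma general_position_exists: "\<exists>P. finite P \<and> card P = n \<and> general_position P"
proof -
  define f :: "nat \<Rightarrow> real^2" where "f i = vector [real i, (real i)\<^sup>2]" for i
  have f1: "f i $ 1 = real i" and f2: "f i $ 2 = (real i)\<^sup>2" for i
    by (simp_all add: f_def)
  have inj: "inj f"
    by (rule injI) (metis f1 of_nat_eq_iff)
  have "\<not> collinear S" if S: "S \<subseteq> f ` {..<n}" "card S = 3" for S
  proof
    assume "collinear S"
    then obtain u where u: "\<And>x y. x \<in> S \<Longrightarrow> y \<in> S \<Longrightarrow> \<exists>c. x - y = c *\<^sub>R u"
      unfolding collinear_def by blast
    obtain a b c where abc: "S = {a, b, c}" "a \<noteq> b" "b \<noteq> c" "a \<noteq> c"
      using S(2) by (auto simp: card_3_iff)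
    then obtain i j k where ijk: "a = f i" "b = f j" "c = f k"
      using S(1) by auto
    then have ne: "i \<noteq> j" "j \<noteq> k" "i \<noteq> k"
      using abc by auto
    obtain s where "f i - f j = s *\<^sub>R u" using u[of a b] abc ijk by auto
    then have s: "real i - real j = s * u $ 1" "(real i)\<^sup>2 - (real j)\<^sup>2 = s * u $ 2"
      by (metis f1 vector_minus_component vector_scaleR_component real_scaleR_def)
         (metis \<open>f i - f j = s *\<^sub>R u\<close> f2 vector_minus_component vector_scaleR_component real_scaleR_def)
    obtain t where "f j - f k = t *\<^sub>R u" using u[of b c] abc ijk by auto
    then have t: "real j - real k = t * u $ 1" "(real j)\<^sup>2 - (real k)\<^sup>2 = t * u $ 2"
      by (metis f1 vector_minus_component vector_scaleR_component real_scaleR_def)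
         (metis \<open>f j - f k = t *\<^sub>R u\<close> f2 vector_minus_component vector_scaleR_component real_scaleR_def)
    have "(real i - real j) * ((real j)\<^sup>2 - (real k)\<^sup>2)
        = (real j - real k) * ((real i)\<^sup>2 - (real j)\<^sup>2)"
      by (simp add: s t)
    then have "(real i - real j) * (real j - real k) * (real k - real i) = 0"
      by (simp add: power2_eq_square algebra_simps)
    then show False using ne by simp
  qed
  then have "general_position (f ` {..<n})"
    by (simp add: general_position_def)
  moreover have "card (f ` {..<n}) = n"
    using inj by (simp add: card_image inj_on_def)
  ultimately show ?thesis by blast
qed

lemma min_peelings_attained:
  "\<exists>P. finite P \<and> card P = n \<and> general_position P \<and> num_peelings P = min_peelings n"
proof -
  have "num_peelings ` {P. finite P \<and> card P = n \<and> general_position P} \<noteq> {}"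
    using general_position_exists by blast
  from Inf_nat_def1[OF this] show ?thesis
    unfolding min_peelings_def by auto
qed

end

theory Submission
  imports Defs "HOL-Library.Sublist"
begin

text \<open>
  Three smaller sets are flattened onto short segments and put at the corners of a triangle, each
  segment pointing into the triangle so that its line separates the other two corners. As long as
  all three clusters survive, only their outermost points are vertices of the hull, so that every
  cluster is peeled in one forced order. Once a cluster is exhausted, the peelings of the two
  remaining suffixes are merely interleaved, which costs a factor of \<open>2\<close> per point.

  For the recursion one bounds all suffixes of the \<open>n\<close>-point set in its order along the segment:
  removing the first \<open>k\<close> points leaves at most \<open>9.78^n / 2^k / 500\<close> peelings. With clusters of size
  about \<open>n / 3\<close> the induction would close for every base above \<open>8\<close> up to a constant factor.
  Two surviving clusters contribute the factor \<open>1/500\<close> twice, and this absorbs the constant. The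
  trivial bound \<open>n!\<close> starts the induction for \<open>5 \<le> n \<le> 15\<close>, and from \<open>n = 16\<close> on all three clusters
  have at least \<open>5\<close> points.
\<close>

section \<open>Counting peeling sequences\<close>

definition hull_vertices :: "(real^2) set \<Rightarrow> (real^2) set" where
  "hull_vertices P = {v. v extreme_point_of (convex hull P)}"

lemma hull_vertices_subset: "hull_vertices P \<subseteq> P"
  using extreme_point_of_convex_hull by (auto simp: hull_vertices_def)

text \<open>Shrinking the hull only removes segments that could contain \<open>v\<close>, so a
  surviving vertex stays a vertex.\<close>

lemma hull_vertices_mono:
  assumes "v \<in> hull_vertices Q" "v \<in> P" "P \<subseteq> Q"
  shows "v \<in> hull_vertices P"
  using assms(1) hull_mono[OF assms(3), of convex] hull_inc[OF assms(2), of convex]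
  unfolding hull_vertices_def extreme_point_of_def by blast

lemma Cons_in_peeling_sequences:
  "x # xs \<in> peeling_sequences P \<longleftrightarrow>
     x \<in> hull_vertices P \<and> xs \<in> peeling_sequences (P - {x})"
proof -
  have "x # xs \<in> permutations_of_set P \<longleftrightarrow> x \<in> P \<and> xs \<in> permutations_of_set (P - {x})"
    by (auto simp: permutations_of_set_def)
  moreover have "(\<forall>i<length (x # xs). (x # xs) ! i \<in> hull_vertices (P - set (take i (x # xs)))) \<longleftrightarrow>
      x \<in> hull_vertices P \<and> (\<forall>i<length xs. xs ! i \<in> hull_vertices (P - {x} - set (take i xs)))"
    by (simp add: All_less_Suc2 Diff_insert2[symmetric])
  ultimately show ?thesis
    using hull_vertices_subset[of P]
    unfolding peeling_sequences_def hull_vertices_def[symmetric] mem_Collect_eq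
    by (auto simp: hull_vertices_def)
qed

lemma num_peelings_empty [simp]: "num_peelings {} = 1"
proof -
  have "peeling_sequences {} = {[]}"
    by (auto simp: peeling_sequences_def)
  then show ?thesis
    by (simp add: num_peelings_def)
qed

lemma finite_peeling_sequences: "finite (peeling_sequences P)"
  by (simp add: peeling_sequences_def)

lemma num_peelings_rec:
  assumes "finite P" "P \<noteq> {}"
  shows "num_peelings P = (\<Sum>v\<in>hull_vertices P. num_peelings (P - {v}))"
proof -
  have "ps \<in> peeling_sequences P \<longleftrightarrow>
      ps \<in> (\<Union>v\<in>hull_vertices P. (#) v ` peeling_sequences (P - {v}))" for ps
  proof (cases ps)
    case Nil
    then show ?thesis
      using assms(2) by (auto simp: peeling_sequences_def permutations_of_set_def)
  next
    case (Cons x xs)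
    then show ?thesis
      using Cons_in_peeling_sequences[of x xs P] by auto
  qed
  then have "peeling_sequences P = (\<Union>v\<in>hull_vertices P. (#) v ` peeling_sequences (P - {v}))"
    by blast
  moreover have "card \<dots> = (\<Sum>v\<in>hull_vertices P. card ((#) v ` peeling_sequences (P - {v})))"
    using finite_subset[OF hull_vertices_subset assms(1)] finite_peeling_sequences
    by (intro card_UN_disjoint) auto
  ultimately show ?thesis
    by (simp add: num_peelings_def card_image)
qed

section \<open>Bounds for subsets, unions and affine images\<close>

lemma num_peelings_le_fact:
  assumes "finite P"
  shows "num_peelings P \<le> fact (card P)"
proof -
  have "card (peeling_sequences P) \<le> card (permutations_of_set P)"
    by (rule card_mono) (auto simp: peeling_sequences_def)
  then show ?thesis
    using assms by (simp add: num_peelings_def)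
qed

text \<open>Induction on the size. If \<open>p\<close> is a vertex, the left side is one summand of
  the recursion for \<open>P\<close>. Otherwise \<open>P\<close> and \<open>P - {p}\<close> have the
  same hull, and the two recursions are compared term by term.\<close>

lemma num_peelings_delete_le:
  assumes "finite P" "p \<in> P"
  shows "num_peelings (P - {p}) \<le> num_peelings P"
  using assms
proof (induction "card P" arbitrary: P rule: less_induct)
  case less
  have rec: "num_peelings P = (\<Sum>v\<in>hull_vertices P. num_peelings (P - {v}))"
    using less.prems by (intro num_peelings_rec) auto
  have fin: "finite (hull_vertices P)"
    using finite_subset[OF hull_vertices_subset less.prems(1)] .
  show ?case
  \<comment> \<open>Including \<open>P = {p}\<close> here makes \<open>P - {p}\<close> nonempty in
    the other case, so that the recursion applies to it.\<close>
  proof (cases "p \<in> hull_vertices P \<or> P = {p}")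
    case True
    then have "p \<in> hull_vertices P"
      by (auto simp: hull_vertices_def)
    then show ?thesis
      unfolding rec using fin by (intro member_le_sum) auto
  next
    case False
    \<comment> \<open>A polygon is the hull of its vertices, none of which is
      \<open>p\<close>.\<close>
    have "convex hull P = convex hull (hull_vertices P)"
      unfolding hull_vertices_def
      using less.prems(1) by (intro Krein_Milman_Minkowski compact_convex_hull finite_imp_compact) auto
    moreover have "hull_vertices P \<subseteq> P - {p}"
      using False hull_vertices_subset by auto
    ultimately have "convex hull (P - {p}) = convex hull P"
      using hull_mono[of "hull_vertices P" "P - {p}" convex] hull_mono[of "P - {p}" P convex] by auto
    then have same: "hull_vertices (P - {p}) = hull_vertices P"
      by (simp add: hull_vertices_def)
    have "num_peelings (P - {p}) = (\<Sum>v\<in>hull_vertices (P - {p}). num_peelings (P - {p} - {v}))"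
      using less.prems False by (intro num_peelings_rec) auto
    also have "\<dots> \<le> (\<Sum>v\<in>hull_vertices P. num_peelings (P - {v}))"
      unfolding same
    proof (rule sum_mono)
      fix v assume v: "v \<in> hull_vertices P"
      then have "v \<in> P" "v \<noteq> p"
        using hull_vertices_subset False by auto
      then have "num_peelings (P - {v} - {p}) \<le> num_peelings (P - {v})"
        using less.prems by (intro less.hyps card_Diff1_less) auto
      moreover have "P - {v} - {p} = P - {p} - {v}"
        by auto
      ultimately show "num_peelings (P - {p} - {v}) \<le> num_peelings (P - {v})"
        by simp
    qed
    finally show ?thesis
      using rec by simp
  qed
qed

lemma num_peelings_mono:
  assumes "finite Q" "P \<subseteq> Q"
  shows "num_peelings P \<le> num_peelings Q"
proof -
  have "num_peelings (Q - R) \<le> num_peelings Q" if "finite R" for R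
    using that
  proof (induction R)
    case (insert p R)
    have "num_peelings (Q - R - {p}) \<le> num_peelings (Q - R)"
      using assms(1) num_peelings_delete_le[of "Q - R" p] by (cases "p \<in> Q - R") auto
    moreover have "Q - insert p R = Q - R - {p}"
      by auto
    ultimately show ?case
      using insert.IH by simp
  qed simp
  from this[of "Q - P"] assms show ?thesis
    by (simp add: double_diff)
qed

text \<open>A peeling of the union restricts to a peeling of each part, since by
  \<open>hull_vertices_mono\<close> a vertex of the union is a vertex of its part. The power of 2
  bounds the number of ways to interleave.\<close>

lemma num_peelings_Un_le:
  assumes "finite A" "finite B" "A \<inter> B = {}"
  shows "num_peelings (A \<union> B) \<le> 2 ^ (card A + card B) * num_peelings A * num_peelings B"
  using assms
proof (induction "card A + card B" arbitrary: A B rule: less_induct)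
  case less
  show ?case
  proof (cases "A = {} \<or> B = {}")
    case True
    then have "num_peelings (A \<union> B) = num_peelings A * num_peelings B"
      by auto
    moreover have "1 * (num_peelings A * num_peelings B)
        \<le> 2 ^ (card A + card B) * (num_peelings A * num_peelings B)"
      by (intro mult_right_mono) auto
    ultimately show ?thesis
      by (simp only: mult.assoc mult_1_left)
  next
    case False
    define m where "m = card A + card B - 1"
    have m: "card A + card B = Suc m"
      using False less.prems by (auto simp: m_def card_gt_0_iff)
    let ?H = "hull_vertices (A \<union> B)"
    \<comment> \<open>The peelings that start with a point of \<open>C\<close>. Using this once for
      \<open>A\<close> and once for \<open>B\<close> doubles the bound, which raises the exponent
      from \<open>m\<close> to \<open>Suc m\<close>.\<close>
    have step: "(\<Sum>v\<in>?H \<inter> C. num_peelings (C \<union> D - {v})) \<le> 2 ^ m * num_peelings C * num_peelings D"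
      if CD: "finite C" "finite D" "C \<inter> D = {}" "C \<union> D = A \<union> B" "C \<noteq> {}" for C D
    proof -
      have card: "card C + card D = Suc m"
        using CD m less.prems by (metis card_Un_disjoint)
      have "(\<Sum>v\<in>?H \<inter> C. num_peelings (C \<union> D - {v}))
          \<le> (\<Sum>v\<in>?H \<inter> C. 2 ^ m * num_peelings (C - {v}) * num_peelings D)"
      proof (rule sum_mono)
        fix v assume v: "v \<in> ?H \<inter> C"
        then have c: "Suc (card (C - {v})) = card C"
          using CD by (intro card_Suc_Diff1) auto
        have "num_peelings ((C - {v}) \<union> D)
            \<le> 2 ^ (card (C - {v}) + card D) * num_peelings (C - {v}) * num_peelings D"
          using CD c card m by (intro less.hyps) auto
        moreover have "card (C - {v}) + card D = m"
          using c card by simp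
        moreover have "(C - {v}) \<union> D = C \<union> D - {v}"
          using v CD by auto
        ultimately show "num_peelings (C \<union> D - {v}) \<le> 2 ^ m * num_peelings (C - {v}) * num_peelings D"
          by simp
      qed
      also have "\<dots> = 2 ^ m * num_peelings D * (\<Sum>v\<in>?H \<inter> C. num_peelings (C - {v}))"
        by (simp add: sum_distrib_left mult_ac)
      also have "(\<Sum>v\<in>?H \<inter> C. num_peelings (C - {v})) \<le> (\<Sum>v\<in>hull_vertices C. num_peelings (C - {v}))"
      proof (rule sum_mono2)
        show "?H \<inter> C \<subseteq> hull_vertices C"
          using CD hull_vertices_mono by blast
      qed (use finite_subset[OF hull_vertices_subset CD(1)] in auto)
      also have "\<dots> = num_peelings C"
        using num_peelings_rec CD by simp
      finally show ?thesis
        by (simp add: mult_ac)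
    qed
    have "num_peelings (A \<union> B) = (\<Sum>v\<in>?H. num_peelings (A \<union> B - {v}))"
      using less.prems False by (intro num_peelings_rec) auto
    also have "?H = (?H \<inter> A) \<union> (?H \<inter> B)"
      using hull_vertices_subset[of "A \<union> B"] by auto
    also have "(\<Sum>v\<in>\<dots>. num_peelings (A \<union> B - {v}))
        = (\<Sum>v\<in>?H \<inter> A. num_peelings (A \<union> B - {v})) + (\<Sum>v\<in>?H \<inter> B. num_peelings (B \<union> A - {v}))"
      using less.prems by (subst sum.union_disjoint) (auto simp: Un_commute)
    also have "\<dots> \<le> 2 ^ m * num_peelings A * num_peelings B + 2 ^ m * num_peelings B * num_peelings A"
      using less.prems False by (intro add_mono step) auto
    finally show ?thesis
      unfolding m by (simp add: mult_ac)
  qed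
qed

text \<open>Injective affine maps carry hulls to hulls and open segments to open segments, hence
  vertices to vertices, and the recursion is transported.\<close>

lemma num_peelings_affine_image:
  fixes L :: "real^2 \<Rightarrow> real^2"
  assumes "linear L" "inj L" "finite P"
  shows "num_peelings ((\<lambda>p. v + L p) ` P) = num_peelings P"
proof -
  define T where "T = (\<lambda>p. v + L p)"
  have inj: "inj T"
    using assms(2) by (auto simp: T_def inj_on_def)
  have hv: "hull_vertices (T ` Q) = T ` hull_vertices Q" for Q
  proof -
    have "T ` Q = (+) v ` (L ` Q)"
      by (simp add: T_def image_image)
    then have ch: "convex hull (T ` Q) = (+) v ` (L ` (convex hull Q))"
      by (simp add: convex_hull_translation convex_hull_linear_image assms(1))
    have "{y. y extreme_point_of L ` C} = L ` {x. x extreme_point_of C}" for C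
      using assms(2)
      by (auto simp: extreme_point_of_def open_segment_linear_image[OF assms(1,2)] inj_eq)
    then show ?thesis
      unfolding hull_vertices_def ch extreme_points_of_translation
      by (simp add: T_def image_image)
  qed
  have "num_peelings (T ` P) = num_peelings P"
    using assms(3)
  proof (induction "card P" arbitrary: P rule: less_induct)
    case less
    show ?case
    proof (cases "P = {}")
      case False
      have "num_peelings (T ` P) = (\<Sum>v\<in>T ` hull_vertices P. num_peelings (T ` P - {v}))"
        using less.prems False by (simp add: num_peelings_rec hv)
      also have "\<dots> = (\<Sum>v\<in>hull_vertices P. num_peelings (T ` P - {T v}))"
        using inj by (subst sum.reindex) (auto simp: inj_on_def)
      also have "\<dots> = (\<Sum>v\<in>hull_vertices P. num_peelings (P - {v}))"
      proof (rule sum.cong[OF refl])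
        fix v assume "v \<in> hull_vertices P"
        then have "v \<in> P"
          using hull_vertices_subset by auto
        then have "num_peelings (T ` (P - {v})) = num_peelings (P - {v})"
          using less.prems by (intro less.hyps card_Diff1_less) auto
        then show "num_peelings (T ` P - {T v}) = num_peelings (P - {v})"
          using inj by (simp add: image_set_diff)
      qed
      finally show ?thesis
        using less.prems False by (simp add: num_peelings_rec)
    qed simp
  qed
  then show ?thesis
    by (simp add: T_def)
qed

text \<open>
  The three summands belong to the cluster that is exhausted first; each of them is preserved
  because \<open>1/4 + 1/4 + 1/2 = 1\<close>.
\<close>

lemma num_peelings_three_le:
  fixes a b c :: real
  assumes dist: "distinct (A @ B @ C)"
    and trap: "\<And>A' B' C'. suffix A' A \<Longrightarrow> suffix B' B \<Longrightarrow> suffix C' C \<Longrightarrow>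
      A' \<noteq> [] \<Longrightarrow> B' \<noteq> [] \<Longrightarrow> C' \<noteq> [] \<Longrightarrow>
      hull_vertices (set A' \<union> set B' \<union> set C') \<subseteq> {hd A', hd B', hd C'}"
    and A: "\<And>A'. suffix A' A \<Longrightarrow> real (num_peelings (set A')) \<le> a * 2 ^ length A'"
    and B: "\<And>B'. suffix B' B \<Longrightarrow> real (num_peelings (set B')) \<le> b * 2 ^ length B'"
    and C: "\<And>C'. suffix C' C \<Longrightarrow> real (num_peelings (set C')) \<le> c * 2 ^ length C'"
    and suf: "suffix A' A" "suffix B' B" "suffix C' C"
  shows "real (num_peelings (set A' \<union> set B' \<union> set C'))
    \<le> a * b * 4 ^ (length A' + length B') * 2 ^ length C'
      + a * c * 4 ^ (length A' + length C') * 2 ^ length B'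
      + b * c * 4 ^ (length B' + length C') * 2 ^ length A'"
  using suf
proof (induction "length A' + length B' + length C'" arbitrary: A' B' C' rule: less_induct)
  case less
  \<comment> \<open>The empty suffix has exactly one peeling, so each of the three constants is at
    least 1.\<close>
  have pos: "a \<ge> 0" "b \<ge> 0" "c \<ge> 0"
    using A[of "[]"] B[of "[]"] C[of "[]"] by auto
  have sub: "set A' \<subseteq> set A" "set B' \<subseteq> set B" "set C' \<subseteq> set C"
    using less.prems by (auto dest: set_mono_suffix)
  have dist': "distinct A'" "distinct B'" "distinct C'"
    using dist less.prems by (auto simp: suffix_def)
  have disj: "set A' \<inter> set B' = {}" "set A' \<inter> set C' = {}" "set B' \<inter> set C' = {}"
    using dist sub by auto
  \<comment> \<open>Per point, one factor 2 comes from interleaving and one from the assumed bounds;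
    hence the base 4.\<close>
  have pair: "real (num_peelings (set U \<union> set V)) \<le> x * y * 4 ^ (length U + length V)"
    if "distinct U" "distinct V" "set U \<inter> set V = {}"
      "real (num_peelings (set U)) \<le> x * 2 ^ length U"
      "real (num_peelings (set V)) \<le> y * 2 ^ length V" for U V x y
  proof -
    have "real (num_peelings (set U \<union> set V))
        \<le> real (2 ^ (length U + length V) * num_peelings (set U) * num_peelings (set V))"
      using num_peelings_Un_le[of "set U" "set V"] that(1-3)
      by (simp only: of_nat_le_iff distinct_card List.finite_set)
    also have "\<dots> = 2 ^ (length U + length V) * (real (num_peelings (set U)) * real (num_peelings (set V)))"
      by simp
    also have "\<dots> \<le> 2 ^ (length U + length V) * ((x * 2 ^ length U) * (y * 2 ^ length V))"
      using that(4,5) by (intro mult_left_mono mult_mono) (auto intro: order_trans[rotated])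
    also have "\<dots> = x * y * (2 * 2) ^ (length U + length V)"
      by (simp only: power_mult_distrib power_add mult_ac)
    finally show ?thesis
      by simp
  qed
  have nonneg: "0 \<le> x * y * 4 ^ i * 2 ^ j" if "x \<ge> 0" "y \<ge> 0" for x y :: real and i j :: nat
    using that by simp
  consider "A' = []" | "B' = []" | "C' = []" | "A' \<noteq> []" "B' \<noteq> []" "C' \<noteq> []"
    by blast
  then show ?case
  proof cases
    case 1
    \<comment> \<open>With \<open>A'\<close> empty, the pair bound is exactly the third summand and
      the other two are nonnegative. The next two cases are symmetric.\<close>
    have "real (num_peelings (set B' \<union> set C')) \<le> b * c * 4 ^ (length B' + length C')"
      using dist' disj less.prems by (intro pair B C) auto
    then show ?thesis
      unfolding 1 list.size(3) list.set(1) Un_empty_left Un_empty_right power_0 mult_1_right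
      using nonneg[OF pos(1) pos(2), of "0 + length B'" "length C'"]
        nonneg[OF pos(1) pos(3), of "0 + length C'" "length B'"]
      by linarith
  next
    case 2
    have "real (num_peelings (set A' \<union> set C')) \<le> a * c * 4 ^ (length A' + length C')"
      using dist' disj less.prems by (intro pair A C) auto
    then show ?thesis
      unfolding 2 list.size(3) list.set(1) Un_empty_left Un_empty_right power_0 mult_1_right
      using nonneg[OF pos(1) pos(2), of "length A' + 0" "length C'"]
        nonneg[OF pos(2) pos(3), of "0 + length C'" "length A'"]
      by linarith
  next
    case 3
    have "real (num_peelings (set A' \<union> set B')) \<le> a * b * 4 ^ (length A' + length B')"
      using dist' disj less.prems by (intro pair A B) auto
    then show ?thesis
      unfolding 3 list.size(3) list.set(1) Un_empty_left Un_empty_right power_0 mult_1_right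
      using nonneg[OF pos(1) pos(3), of "length A' + 0" "length B'"]
        nonneg[OF pos(2) pos(3), of "length B' + 0" "length A'"]
      by linarith
  next
    case 4
    obtain p A2 q B2 r C2 where l: "A' = p # A2" "B' = q # B2" "C' = r # C2"
      using 4 by (meson neq_Nil_conv)
    have suf2: "suffix A2 A" "suffix B2 B" "suffix C2 C"
      using less.prems unfolding l by (auto dest: suffix_ConsD)
    let ?S = "set A' \<union> set B' \<union> set C'"
    have "num_peelings ?S = (\<Sum>v\<in>hull_vertices ?S. num_peelings (?S - {v}))"
      using 4 by (intro num_peelings_rec) auto
    \<comment> \<open>The sum is extended to all three heads, whether or not each of them is a
      vertex.\<close>
    also have "\<dots> \<le> (\<Sum>v\<in>{p, q, r}. num_peelings (?S - {v}))"
      using trap[OF less.prems 4] by (intro sum_mono2) (auto simp: l)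
    also have "\<dots> = num_peelings (set A2 \<union> set B' \<union> set C') + num_peelings (set A' \<union> set B2 \<union> set C')
        + num_peelings (set A' \<union> set B' \<union> set C2)"
    proof -
      have "?S - {p} = set A2 \<union> set B' \<union> set C'" "?S - {q} = set A' \<union> set B2 \<union> set C'"
        "?S - {r} = set A' \<union> set B' \<union> set C2" "p \<noteq> q" "p \<noteq> r" "q \<noteq> r"
        using dist' disj by (auto simp: l)
      then show ?thesis
        by simp
    qed
    finally have "real (num_peelings ?S) \<le> real (num_peelings (set A2 \<union> set B' \<union> set C'))
        + real (num_peelings (set A' \<union> set B2 \<union> set C')) + real (num_peelings (set A' \<union> set B' \<union> set C2))"
      by linarith
    also have "\<dots> \<le> a * b * 4 ^ (length A' + length B') * 2 ^ length C'
      + a * c * 4 ^ (length A' + length C') * 2 ^ length B'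
      + b * c * 4 ^ (length B' + length C') * 2 ^ length A'"
      using less.hyps[of A2 B' C'] less.hyps[of A' B2 C'] less.hyps[of A' B' C2] suf2 less.prems
      by (simp add: l algebra_simps)
    finally show ?thesis .
  qed
qed

section \<open>Flattened clusters\<close>

definition cross :: "real^2 \<Rightarrow> real^2 \<Rightarrow> real" where
  "cross u w = u $ 1 * w $ 2 - u $ 2 * w $ 1"

text \<open>Twice the signed area of the triangle; positive exactly for counterclockwise
  triples.\<close>

definition ori :: "real^2 \<Rightarrow> real^2 \<Rightarrow> real^2 \<Rightarrow> real" where
  "ori a b c = cross (b - a) (c - a)"

lemma ori_rotate: "ori b c a = ori a b c"
  and ori_swap: "ori b a c = - ori a b c"
  by (simp_all add: ori_def cross_def algebra_simps)

text \<open>General position in terms of determinants, whose signs can be followed through the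
  squeezing maps.\<close>

definition no_three_collinear :: "(real^2) set \<Rightarrow> bool" where
  "no_three_collinear S \<longleftrightarrow>
     (\<forall>a\<in>S. \<forall>b\<in>S. \<forall>c\<in>S. a \<noteq> b \<longrightarrow> b \<noteq> c \<longrightarrow> a \<noteq> c \<longrightarrow> ori a b c \<noteq> 0)"

lemma general_position_if_no_three_collinear:
  assumes "no_three_collinear P"
  shows "general_position P"
  unfolding general_position_def
proof (intro allI impI notI)
  fix S assume S: "S \<subseteq> P" "card S = 3" "collinear S"
  then obtain a b c where abc: "S = {a, b, c}" "a \<noteq> b" "b \<noteq> c" "a \<noteq> c"
    by (auto simp: card_3_iff)
  obtain u where u: "\<And>x y. x \<in> S \<Longrightarrow> y \<in> S \<Longrightarrow> \<exists>t. x - y = t *\<^sub>R u"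
    using S(3) unfolding collinear_def by blast
  obtain s t where "b - a = s *\<^sub>R u" "c - a = t *\<^sub>R u"
    using u[of b a] u[of c a] abc by auto
  then have "ori a b c = 0"
    by (simp add: ori_def cross_def)
  then show False
    using assms abc S(1) by (auto simp: no_three_collinear_def)
qed

text \<open>The hypotheses give one common sign to the three signed areas that serve as barycentric
  coordinates of \<open>b\<close> in the triangle \<open>a\<close>, \<open>q\<close>,
  \<open>r\<close>. So \<open>b\<close> lies in this triangle and is redundant for the hull.\<close>

lemma not_hull_vertex_in_triangle:
  assumes "ori a b q > 0" "ori a b r < 0" "ori b q r < 0" "{a, b, q, r} \<subseteq> S"
  shows "b \<notin> hull_vertices S"
proof
  assume "b \<in> hull_vertices S"
  then have b: "b \<in> hull_vertices {a, b, q, r}"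
    by (rule hull_vertices_mono) (use assms(4) in auto)
  \<comment> \<open>\<open>W\<close> equals \<open>ori a q r\<close>, decomposed at \<open>b\<close>
    into three triangles.\<close>
  define W where "W = ori b q r + ori a b r - ori a b q"
  have W: "W < 0"
    using assms by (simp add: W_def)
  have "W *\<^sub>R b = ori b q r *\<^sub>R a + ori a b r *\<^sub>R q + (- ori a b q) *\<^sub>R r"
    by (simp add: vec_eq_iff forall_2 W_def ori_def cross_def algebra_simps)
  then have "b = inverse W *\<^sub>R (ori b q r *\<^sub>R a + ori a b r *\<^sub>R q + (- ori a b q) *\<^sub>R r)"
    using W by (metis less_irrefl scaleR_left_imp_eq scaleR_scaleR left_inverse scaleR_one)
  then have "b = (ori b q r / W) *\<^sub>R a + (ori a b r / W) *\<^sub>R q + (- ori a b q / W) *\<^sub>R r"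
    by (simp add: scaleR_add_right scaleR_diff_right divide_inverse mult.commute)
  moreover have "ori b q r / W + ori a b r / W + (- ori a b q / W) = 1"
    using W by (simp only: add_divide_distrib[symmetric]) (simp add: W_def)
  moreover have "0 \<le> ori b q r / W" "0 \<le> ori a b r / W" "0 \<le> - ori a b q / W"
    using W assms by (simp_all add: zero_le_divide_iff divide_le_0_iff)
  ultimately have "b \<in> convex hull {a, q, r}"
    unfolding convex_hull_3 by blast
  moreover have "{a, b, q, r} = insert b {a, q, r}"
    by auto
  ultimately have "convex hull {a, b, q, r} = convex hull {a, q, r}"
    by (simp only: hull_redundant)
  then have "b \<in> hull_vertices {a, q, r}"
    using b by (simp add: hull_vertices_def)
  then have "b \<in> {a, q, r}"
    using hull_vertices_subset by blast
  then show False
    using assms by (auto simp: ori_def cross_def)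
qed

text \<open>
  Squeezes the plane onto the segment from \<open>v\<close> in direction \<open>d\<close>, to first order in \<open>e\<close>; the
  transversal extent is only of order \<open>e\<^sup>2\<close>.
\<close>

definition flat :: "real^2 \<Rightarrow> real^2 \<Rightarrow> real \<Rightarrow> real^2 \<Rightarrow> real^2" where
  "flat v d e p = v + vector [e * p $ 1 * d $ 1, e * p $ 1 * d $ 2 + e\<^sup>2 * p $ 2]"

lemma flat_nth [simp]:
  "flat v d e p $ 1 = v $ 1 + e * p $ 1 * d $ 1"
  "flat v d e p $ 2 = v $ 2 + e * p $ 1 * d $ 2 + e\<^sup>2 * p $ 2"
  by (simp_all add: flat_def)

section \<open>Invariance and limit behaviour under squeezing\<close>

lemma inj_flat:
  assumes "e \<noteq> 0" "d $ 1 \<noteq> 0"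
  shows "inj (flat v d e)"
proof (rule injI)
  fix p q assume *: "flat v d e p = flat v d e q"
  have "p $ 1 = q $ 1"
    using arg_cong[OF *, of "\<lambda>x. x $ 1"] assms by simp
  moreover from this have "p $ 2 = q $ 2"
    using arg_cong[OF *, of "\<lambda>x. x $ 2"] assms by simp
  ultimately show "p = q"
    by (simp add: vec_eq_iff forall_2)
qed

text \<open>The linear part of \<open>flat\<close> is triangular with diagonal entries
  \<open>e * d $ 1\<close> and \<open>e\<^sup>2\<close>; the factor is its determinant.\<close>

lemma ori_flat: "ori (flat v d e a) (flat v d e b) (flat v d e c) = e ^ 3 * d $ 1 * ori a b c"
  by (simp add: ori_def cross_def algebra_simps power2_eq_square power3_eq_cube)

lemma num_peelings_flat:
  assumes "e \<noteq> 0" "d $ 1 \<noteq> 0" "finite P"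
  shows "num_peelings (flat v d e ` P) = num_peelings P"
proof -
  define L where "L = flat 0 d e"
  have "flat v d e = (\<lambda>p. v + L p)"
    by (simp add: L_def flat_def fun_eq_iff)
  moreover have "linear L"
    by (rule linearI) (simp_all add: L_def vec_eq_iff forall_2 algebra_simps)
  moreover have "inj L"
    using inj_flat[OF assms(1,2)] by (simp add: L_def)
  ultimately show ?thesis
    using num_peelings_affine_image assms(3) by simp
qed

text \<open>Two points of the cluster at \<open>v\<close> span a line whose direction is nearly
  \<open>d\<close>. After division by \<open>e\<close>, the orientation is a function
  \<open>G\<close> that tends to the expression in the hypothesis.\<close>

lemma eventually_ori_flat_pair:
  assumes "(b $ 1 - a $ 1) * cross d (v' - v) > 0"
  shows "\<forall>\<^sub>F e in at_right 0. ori (flat v d e a) (flat v d e b) (flat v' d' e q) > 0"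
proof -
  define G where "G e = (b $ 1 - a $ 1) * d $ 1 * (flat v' d' e q $ 2 - flat v d e a $ 2)
    - ((b $ 1 - a $ 1) * d $ 2 + e * (b $ 2 - a $ 2)) * (flat v' d' e q $ 1 - flat v d e a $ 1)" for e
  have "(G \<longlongrightarrow> (b $ 1 - a $ 1) * cross d (v' - v)) (at_right 0)"
    unfolding G_def flat_nth by (auto intro!: tendsto_eq_intros simp: cross_def algebra_simps)
  then have "\<forall>\<^sub>F e in at_right 0. G e > 0"
    using assms by (rule order_tendstoD)
  then show ?thesis
    using eventually_at_right_less[of 0]
  proof eventually_elim
    case (elim e)
    have "ori (flat v d e a) (flat v d e b) (flat v' d' e q) = e * G e"
      by (simp add: G_def ori_def cross_def algebra_simps power2_eq_square)
    then show ?case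
      using elim by simp
  qed
qed

text \<open>Orientation is continuous, and at \<open>e = 0\<close> each cluster collapses to its
  corner.\<close>

lemma eventually_ori_flat_three:
  assumes "ori v v' v'' < 0"
  shows "\<forall>\<^sub>F e in at_right 0. ori (flat v d e a) (flat v' d' e b) (flat v'' d'' e c) < 0"
proof -
  have "((\<lambda>e. ori (flat v d e a) (flat v' d' e b) (flat v'' d'' e c)) \<longlongrightarrow> ori v v' v'') (at_right 0)"
    unfolding ori_def cross_def vector_minus_component flat_nth by (auto intro!: tendsto_eq_intros)
  then show ?thesis
    using assms by (rule order_tendstoD)
qed

lemma eventually_flat_less:
  assumes "v $ 1 < v' $ 1"
  shows "\<forall>\<^sub>F e in at_right 0. flat v d e a $ 1 < flat v' d' e b $ 1"
proof -
  have "((\<lambda>e. flat v' d' e b $ 1 - flat v d e a $ 1) \<longlongrightarrow> v' $ 1 - v $ 1) (at_right 0)"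
    unfolding flat_nth by (auto intro!: tendsto_eq_intros)
  then have "\<forall>\<^sub>F e in at_right 0. flat v' d' e b $ 1 - flat v d e a $ 1 > 0"
    using assms by (intro order_tendstoD) auto
  then show ?thesis
    by simp
qed

text \<open>The condition that traps later cluster points behind earlier ones. Abscissae are
  compared before \<open>F\<close> is applied, since \<open>F\<close> may reverse their
  order.\<close>

definition separates ::
    "(real^2 \<Rightarrow> real^2) \<Rightarrow> (real^2) set \<Rightarrow> (real^2) set \<Rightarrow> (real^2) set \<Rightarrow> bool" where
  "separates F A B C \<longleftrightarrow> (\<forall>a\<in>A. \<forall>b\<in>A. a $ 1 < b $ 1 \<longrightarrow>
     (\<forall>q\<in>B. ori (F a) (F b) q > 0) \<and> (\<forall>r\<in>C. ori (F a) (F b) r < 0))"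

lemma eventually_separates:
  assumes "finite A" "finite B" "finite C" "cross d (v' - v) > 0" "cross d (v'' - v) < 0"
  shows "\<forall>\<^sub>F e in at_right 0. separates (flat v d e) A (flat v' d' e ` B) (flat v'' d'' e ` C)"
  unfolding separates_def ball_simps
proof (intro eventually_ball_finite assms(1) ballI)
  fix a b
  show "\<forall>\<^sub>F e in at_right 0. a $ 1 < b $ 1 \<longrightarrow>
    (\<forall>q\<in>B. ori (flat v d e a) (flat v d e b) (flat v' d' e q) > 0) \<and>
    (\<forall>r\<in>C. ori (flat v d e a) (flat v d e b) (flat v'' d'' e r) < 0)"
  proof (cases "a $ 1 < b $ 1")
    case True
    have "\<forall>\<^sub>F e in at_right 0. \<forall>q\<in>B. ori (flat v d e a) (flat v d e b) (flat v' d' e q) > 0"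
      using True assms by (intro eventually_ball_finite ballI eventually_ori_flat_pair) auto
    \<comment> \<open>Exchanging \<open>a\<close> and \<open>b\<close> makes both factors negative
      and so reduces this side to the positive one.\<close>
    moreover have "\<forall>\<^sub>F e in at_right 0. \<forall>r\<in>C. ori (flat v d e b) (flat v d e a) (flat v'' d'' e r) > 0"
      using True assms
      by (intro eventually_ball_finite ballI eventually_ori_flat_pair mult_neg_neg) auto
    ultimately show ?thesis
      by eventually_elim (simp add: ori_swap[of "flat v d _ a" "flat v d _ b"])
  qed simp
qed

section \<open>Sorted lists and the gluing of three clusters\<close>

abbreviation x_sorted :: "(real^2) list \<Rightarrow> bool" where
  "x_sorted \<equiv> sorted_wrt (\<lambda>p q. p $ 1 < q $ 1)"

lemma x_sorted_distinct: "x_sorted ps \<Longrightarrow> distinct ps"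
  by (induction ps) auto

lemma x_sorted_linear:
  assumes "x_sorted ps" "a \<in> set ps" "b \<in> set ps" "a \<noteq> b"
  shows "a $ 1 < b $ 1 \<or> b $ 1 < a $ 1"
  using assms by (induction ps) auto

text \<open>Supplies the pair to which \<open>separates\<close> is applied: the head of a surviving
  suffix and any other member.\<close>

lemma suffix_map_x_sorted:
  assumes "x_sorted X" "suffix A (map F X)" "A \<noteq> []" "y \<in> set A" "y \<noteq> hd A"
  obtains a b where "a \<in> set X" "b \<in> set X" "a $ 1 < b $ 1" "hd A = F a" "y = F b"
proof -
  obtain k where "A = map F (drop k X)"
    using assms(2) by (metis suffix_def append_eq_conv_conj drop_map)
  moreover obtain a W where W: "drop k X = a # W"
    using assms(3) calculation by (cases "drop k X") auto
  moreover obtain b where "b \<in> set W" "y = F b"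
    using assms(4,5) calculation by auto
  moreover have "x_sorted (a # W)"
    using sorted_wrt_drop[OF assms(1), of k] W by simp
  ultimately show ?thesis
    using that[of a b] set_drop_subset[of k X] by auto
qed

text \<open>Two of any three points lie in the same part, and a cyclic rotation, which preserves the
  orientation, brings them to the front.\<close>

lemma no_three_collinear_Un:
  assumes "no_three_collinear A" "no_three_collinear B"
    and "\<And>a a' b. a \<in> A \<Longrightarrow> a' \<in> A \<Longrightarrow> a \<noteq> a' \<Longrightarrow> b \<in> B \<Longrightarrow> ori a a' b \<noteq> 0"
    and "\<And>b b' a. b \<in> B \<Longrightarrow> b' \<in> B \<Longrightarrow> b \<noteq> b' \<Longrightarrow> a \<in> A \<Longrightarrow> ori b b' a \<noteq> 0"
  shows "no_three_collinear (A \<union> B)"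
  unfolding no_three_collinear_def
proof (intro ballI impI)
  fix a b c assume *: "a \<in> A \<union> B" "b \<in> A \<union> B" "c \<in> A \<union> B" "a \<noteq> b" "b \<noteq> c" "a \<noteq> c"
  have "ori a b c = ori b c a" "ori a b c = ori c a b"
    by (simp_all add: ori_rotate)
  then show "ori a b c \<noteq> 0"
    using * assms(3)[of a b c] assms(3)[of b c a] assms(3)[of c a b]
      assms(4)[of a b c] assms(4)[of b c a] assms(4)[of c a b] assms(1,2)
    unfolding no_three_collinear_def by (metis UnE)
qed

lemma no_three_collinear_flat:
  assumes "e > 0" "d $ 1 \<noteq> 0" "no_three_collinear S"
  shows "no_three_collinear (flat v d e ` S)"
  unfolding no_three_collinear_def
proof (clarsimp simp: ori_flat)
  fix a b c
  assume "a \<in> S" "b \<in> S" "c \<in> S" "flat v d e a \<noteq> flat v d e b" "flat v d e b \<noteq> flat v d e c"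
    "flat v d e a \<noteq> flat v d e c"
  moreover from this have "a \<noteq> b" "b \<noteq> c" "a \<noteq> c"
    by auto
  ultimately show "e \<noteq> 0 \<and> d $ 1 \<noteq> 0 \<and> ori a b c \<noteq> 0"
    using assms by (auto simp: no_three_collinear_def)
qed

text \<open>The conditions relating different clusters are finitely many strict inequalities that
  hold for all small \<open>e > 0\<close>, so one \<open>e\<close> serves them all. The glued list
  is sorted again and can itself become a cluster.\<close>

lemma exists_three_clusters:
  assumes sorted: "x_sorted X" "x_sorted Y" "x_sorted Z"
    and gp: "no_three_collinear (set X)" "no_three_collinear (set Y)" "no_three_collinear (set Z)"
  obtains F G H where
    "x_sorted (map F X @ map G Y @ rev (map H Z))"
    "no_three_collinear (set (map F X @ map G Y @ rev (map H Z)))"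
    "\<And>S. finite S \<Longrightarrow> num_peelings (F ` S) = num_peelings S"
    "\<And>S. finite S \<Longrightarrow> num_peelings (G ` S) = num_peelings S"
    "\<And>S. finite S \<Longrightarrow> num_peelings (H ` S) = num_peelings S"
    "\<And>A B C. suffix A (map F X) \<Longrightarrow> suffix B (map G Y) \<Longrightarrow> suffix C (map H Z) \<Longrightarrow>
      A \<noteq> [] \<Longrightarrow> B \<noteq> [] \<Longrightarrow> C \<noteq> [] \<Longrightarrow>
      hull_vertices (set A \<union> set B \<union> set C) \<subseteq> {hd A, hd B, hd C}"
proof -
  \<comment> \<open>The corners run clockwise with increasing abscissae. Each direction has the
    cyclically next corner on its left and the previous one on its right. The negative first
    coordinate of \<open>dZ\<close> reverses the third cluster, hence \<open>rev\<close> in the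
    glued list.\<close>
  define vX vY vZ :: "real^2" where v: "vX = vector [0, 0]" "vY = vector [1, 1]" "vZ = vector [2, 0]"
  define dX dY dZ :: "real^2" where d: "dX = vector [2, 1]" "dY = vector [1, -2]" "dZ = vector [-2, 1]"
  have ev: "\<forall>\<^sub>F e in at_right 0. \<forall>p\<in>S. \<forall>q\<in>T. flat v d e p $ 1 < flat v' d' e q $ 1"
    if "finite S" "finite T" "v $ 1 < v' $ 1" for S T v d v' d'
    using that by (intro eventually_ball_finite ballI eventually_flat_less)
  let ?F = "flat vX dX" and ?G = "flat vY dY" and ?H = "flat vZ dZ"
  have "\<forall>\<^sub>F e in at_right (0::real). 0 < e \<and>
    separates (?F e) (set X) (?G e ` set Y) (?H e ` set Z) \<and>
    separates (?G e) (set Y) (?H e ` set Z) (?F e ` set X) \<and>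
    separates (?H e) (set Z) (?F e ` set X) (?G e ` set Y) \<and>
    (\<forall>a\<in>set X. \<forall>b\<in>set Y. \<forall>c\<in>set Z. ori (?F e a) (?G e b) (?H e c) < 0) \<and>
    (\<forall>p\<in>set X. \<forall>q\<in>set Y. ?F e p $ 1 < ?G e q $ 1) \<and>
    (\<forall>p\<in>set X. \<forall>q\<in>set Z. ?F e p $ 1 < ?H e q $ 1) \<and>
    (\<forall>p\<in>set Y. \<forall>q\<in>set Z. ?G e p $ 1 < ?H e q $ 1)"
    by (intro eventually_conj eventually_separates eventually_ball_finite[OF List.finite_set] ballI
        eventually_ori_flat_three ev eventually_at_right_less)
      (simp_all add: v d cross_def ori_def)
  from eventually_happens'[OF trivial_limit_at_right_real this]
  obtain e where e: "0 < e"
    and sep: "separates (?F e) (set X) (?G e ` set Y) (?H e ` set Z)"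
      "separates (?G e) (set Y) (?H e ` set Z) (?F e ` set X)"
      "separates (?H e) (set Z) (?F e ` set X) (?G e ` set Y)"
    and three: "\<forall>a\<in>set X. \<forall>b\<in>set Y. \<forall>c\<in>set Z. ori (?F e a) (?G e b) (?H e c) < 0"
    and less: "\<forall>p\<in>set X. \<forall>q\<in>set Y. ?F e p $ 1 < ?G e q $ 1"
      "\<forall>p\<in>set X. \<forall>q\<in>set Z. ?F e p $ 1 < ?H e q $ 1"
      "\<forall>p\<in>set Y. \<forall>q\<in>set Z. ?G e p $ 1 < ?H e q $ 1"
    by (elim exE conjE) (rule that)
  define F G H where FGH: "F = ?F e" "G = ?G e" "H = ?H e"
  note sep = sep[folded FGH] and three = three[folded FGH] and less = less[folded FGH]
  \<comment> \<open>Excludes collinear triples with two points in one cluster and the third in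
    another.\<close>
  have pair: "ori a b q \<noteq> 0"
    if W: "x_sorted W" "separates K (set W) B C" and ab: "a \<in> K ` set W" "b \<in> K ` set W" "a \<noteq> b" "q \<in> B \<union> C"
    for K W B C a b q
  proof -
    obtain s t where st: "s \<in> set W" "t \<in> set W" "a = K s" "b = K t"
      using ab by auto
    then show ?thesis
      using W ab ori_swap[of b a q] x_sorted_linear[OF W(1) st(1,2)]
      by (fastforce simp: separates_def)
  qed
  show ?thesis
  proof (rule that[of F G H])
    have "x_sorted (map F X)" "x_sorted (map G Y)" "x_sorted (rev (map H Z))"
      using sorted e
      by (auto simp: sorted_wrt_map sorted_wrt_rev FGH v d elim!: sorted_wrt_mono_rel[rotated])
    then show "x_sorted (map F X @ map G Y @ rev (map H Z))"
      using less by (auto simp: sorted_wrt_append)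
  next
    have *: "no_three_collinear (F ` set X)" "no_three_collinear (G ` set Y)" "no_three_collinear (H ` set Z)"
      unfolding FGH using gp e by (intro no_three_collinear_flat; simp add: d)+
    have ne: "a \<in> F ` set X \<Longrightarrow> b \<in> G ` set Y \<Longrightarrow> c \<in> H ` set Z \<Longrightarrow> ori a b c \<noteq> 0" for a b c
      using three by fastforce
    have "no_three_collinear (F ` set X \<union> (G ` set Y \<union> H ` set Z))"
    proof (intro no_three_collinear_Un *)
      fix a b q assume abq: "a \<in> G ` set Y \<union> H ` set Z" "b \<in> G ` set Y \<union> H ` set Z" "a \<noteq> b"
        "q \<in> F ` set X"
      \<comment> \<open>If \<open>a\<close> and \<open>b\<close> lie in the same cluster,
        \<open>pair\<close> applies; otherwise the triple meets all three clusters and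
        \<open>ne\<close> applies after a rotation or swap.\<close>
      have "ori a b q = ori q a b" "ori a b q = - ori q b a"
        using ori_rotate[of a b q] ori_rotate[of b a q] ori_swap[of b a q] by simp_all
      with abq show "ori a b q \<noteq> 0"
        using pair[OF sorted(2) sep(2), of a b q] pair[OF sorted(3) sep(3), of a b q]
          ne[of q a b] ne[of q b a] by (metis UnE UnI1 UnI2 neg_equal_0_iff_equal)
    qed (rule pair[OF sorted(1) sep(1)] pair[OF sorted(2) sep(2)] pair[OF sorted(3) sep(3)];
        (assumption | erule UnI1 | erule UnI2))+
    then show "no_three_collinear (set (map F X @ map G Y @ rev (map H Z)))"
      by simp
  next
    fix S :: "(real^2) set" assume "finite S"
    then show "num_peelings (F ` S) = num_peelings S" "num_peelings (G ` S) = num_peelings S"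
      "num_peelings (H ` S) = num_peelings S"
      unfolding FGH using e by (simp_all add: num_peelings_flat d)
  next
    fix A B C assume suf: "suffix A (map F X)" "suffix B (map G Y)" "suffix C (map H Z)"
      and ne: "A \<noteq> []" "B \<noteq> []" "C \<noteq> []"
    have hd_mem: "hd A \<in> set A" "hd B \<in> set B" "hd C \<in> set C"
      using ne by simp_all
    obtain x where x: "hd A = F x" "x \<in> set X"
      using hd_mem(1) set_mono_suffix[OF suf(1)] by auto
    obtain y where y: "hd B = G y" "y \<in> set Y"
      using hd_mem(2) set_mono_suffix[OF suf(2)] by auto
    obtain z where z: "hd C = H z" "z \<in> set Z"
      using hd_mem(3) set_mono_suffix[OF suf(3)] by auto
    note hd = x y z
    let ?S = "set A \<union> set B \<union> set C"
    have hds: "F x \<in> ?S" "G y \<in> ?S" "H z \<in> ?S"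
      using hd_mem hd by simp_all
    show "hull_vertices ?S \<subseteq> {hd A, hd B, hd C}"
    proof
      fix p assume p: "p \<in> hull_vertices ?S"
      then have "p \<in> set A \<or> p \<in> set B \<or> p \<in> set C"
        using hull_vertices_subset by blast
      then show "p \<in> {hd A, hd B, hd C}"
      proof (elim disjE; rule_tac ccontr)
        assume "p \<in> set A" "p \<notin> {hd A, hd B, hd C}"
        then obtain a b where ab: "a \<in> set X" "b \<in> set X" "a $ 1 < b $ 1" "hd A = F a" "p = F b"
          using suffix_map_x_sorted[OF sorted(1) suf(1) ne(1)] by blast
        \<comment> \<open>The heads \<open>F a\<close>, \<open>G y\<close> and \<open>H z\<close>
          form a triangle that contains \<open>F b\<close>. The other two clusters follow by cyclic
          symmetry.\<close>
        have "F b \<notin> hull_vertices ?S"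
          using sep(1) three hds ab hd \<open>p \<in> set A\<close>
          by (intro not_hull_vertex_in_triangle[of "F a" _ "G y" "H z"]) (auto simp: separates_def)
        then show False
          using p ab by simp
      next
        assume "p \<in> set B" "p \<notin> {hd A, hd B, hd C}"
        then obtain a b where ab: "a \<in> set Y" "b \<in> set Y" "a $ 1 < b $ 1" "hd B = G a" "p = G b"
          using suffix_map_x_sorted[OF sorted(2) suf(2) ne(2)] by blast
        have "G b \<notin> hull_vertices ?S"
          using sep(2) three hds ab hd \<open>p \<in> set B\<close>
          by (intro not_hull_vertex_in_triangle[of "G a" _ "H z" "F x"]) (auto simp: separates_def ori_rotate[of "G b"])
        then show False
          using p ab by simp
      next
        assume "p \<in> set C" "p \<notin> {hd A, hd B, hd C}"
        then obtain a b where ab: "a \<in> set Z" "b \<in> set Z" "a $ 1 < b $ 1" "hd C = H a" "p = H b"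
          using suffix_map_x_sorted[OF sorted(3) suf(3) ne(3)] by blast
        have "H b \<notin> hull_vertices ?S"
          using sep(3) three hds ab hd \<open>p \<in> set C\<close>
          by (intro not_hull_vertex_in_triangle[of "H a" _ "F x" "G y"])
            (auto simp: separates_def ori_rotate[of "F x" "G y" "H b", symmetric])
        then show False
          using p ab by simp
      qed
    qed
  qed
qed

section \<open>The recursive construction\<close>

lemma fact_power_le: "s > 0 \<Longrightarrow> 2 ^ k * fact s \<le> (fact (s + k) :: nat)"
proof (induction k)
  case (Suc k)
  have "2 ^ Suc k * fact s = (2::nat) * (2 ^ k * fact s)"
    by simp
  also have "\<dots> \<le> (s + Suc k) * fact (s + k)"
    using Suc by (intro mult_mono) auto
  finally show ?case
    by simp
qed simp

lemma two_power_le_fact: "n \<ge> 4 \<Longrightarrow> 2 ^ n \<le> (fact n :: nat)"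
proof (induction n rule: nat_induct_at_least)
  case (Suc n)
  then show ?case
    using mult_mono[of 2 "Suc n" "2 ^ n" "fact n :: nat"] by simp
qed (simp add: fact_numeral)

text \<open>5 and 15 are the ends of the range in which \<open>fact n\<close> is at most
  \<open>9.78 ^ n / 500\<close>; this fails at 4 and at 16. Each removed point divides the factorial
  by at least 2, except for the last factor 1 when \<open>k = n\<close>, where
  \<open>2 ^ n \<le> fact n\<close> is used.\<close>

lemma fact_diff_le:
  assumes "5 \<le> n" "n \<le> 15" "k \<le> n"
  shows "real (fact (n - k)) \<le> 9.78 ^ n / 2 ^ k / 500"
proof -
  have "2 ^ k * fact (n - k) \<le> (fact n :: nat)"
    using fact_power_le[of "n - k" k] two_power_le_fact[of n] assms by (cases "k = n") auto
  then have "real (2 ^ k * fact (n - k)) \<le> real (fact n)"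
    by (simp only: of_nat_le_iff)
  moreover have "real (fact n) \<le> 9.78 ^ n / 500"
  proof -
    have "n \<in> {5, 6, 7, 8, 9, 10, 11, 12, 13, 14, 15}"
      using assms by (simp only: insert_iff empty_iff) presburger
    then show ?thesis
      by (elim insertE emptyE) (simp_all add: fact_numeral power_divide divide_simps)
  qed
  ultimately have "real (fact (n - k)) * 2 ^ k \<le> 9.78 ^ n / 500"
    by (simp add: mult.commute)
  then have "real (fact (n - k)) \<le> 9.78 ^ n / 500 / 2 ^ k"
    by (subst pos_le_divide_eq) auto
  then show ?thesis
    by (simp add: mult.commute)
qed

text \<open>Rests on 8 < 9.78, for clusters with about a third of the points; the 4 pays for the
  rounding by at most two points.\<close>

lemma two_power_le_cluster_power:
  assumes "n \<le> 3 * t + 2"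
  shows "(2::real) ^ n \<le> 4 * 9.78 ^ t"
proof -
  have "(2::real) ^ n \<le> 2 ^ (3 * t + 2)"
    using assms by (intro power_increasing) auto
  also have "\<dots> = 4 * 8 ^ t"
    by (simp add: power_add power_mult)
  also have "\<dots> \<le> 4 * 9.78 ^ t"
    by (intro mult_left_mono power_mono) auto
  finally show ?thesis .
qed

text \<open>Meant for \<open>k\<close> points removed from a first cluster of size
  \<open>k + i\<close>: \<open>p\<close>, \<open>u\<close>, \<open>M\<close>, \<open>R\<close> are 2
  to the powers \<open>k\<close>, \<open>i\<close>, \<open>m\<close>, \<open>r\<close>, and
  \<open>CL\<close>, \<open>CM\<close>, \<open>CR\<close> are the powers of 9.78 for the full
  clusters. Each summand is at most \<open>4 * CL * CM * CR / (p * 250000)\<close>, and 12 / 250000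
  is below 1 / 500.\<close>

lemma three_cluster_estimate:
  fixes p u M R CL CM CR :: real
  assumes pos: "p \<ge> 1" "u > 0" "M > 0" "R > 0" "CL > 0" "CM > 0" "CR > 0"
    and le: "p * u * M * R \<le> 4 * CL" "p * u * M * R \<le> 4 * CM" "p * u * M * R \<le> 4 * CR"
  shows "(CL / (p * u) / 500) * (CM / M / 500) * (u * u * M * M) * R
    + (CL / (p * u) / 500) * (CR / R / 500) * (u * u * R * R) * M
    + (CM / M / 500) * (CR / R / 500) * (M * M * R * R) * u \<le> CL * CM * CR / p / 500"
    (is "?lhs \<le> _")
proof -
  define N where "N = p * u * M * R"
  have N: "N > 0"
    using pos by (simp add: N_def)
  have "?lhs = (CL * CM * (N / p) + CL * CR * (N / p) + CM * CR * N) / (p * 250000)"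
    using pos by (simp add: N_def field_simps)
  also have "\<dots> \<le> (CL * CM * N + CL * CR * N + CM * CR * N) / (p * 250000)"
    using pos N by (intro divide_right_mono add_mono mult_left_mono) (auto simp: field_simps)
  also have "\<dots> \<le> (CL * CM * (4 * CR) + CL * CR * (4 * CM) + CM * CR * (4 * CL)) / (p * 250000)"
    using pos le by (intro divide_right_mono add_mono mult_left_mono) (auto simp: N_def)
  also have "\<dots> \<le> CL * CM * CR / p / 500"
    using pos by (simp add: field_simps)
  finally show ?thesis .
qed

text \<open>Sets with fewer than 5 points carry no bound but still serve as clusters. Sortedness and
  the absence of collinear triples are what allows an arrangement to be squeezed and glued
  again.\<close>

lemma exists_good_arrangement:
  "\<exists>ps. length ps = n \<and> x_sorted ps \<and> no_three_collinear (set ps) \<and>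
     (5 \<le> n \<longrightarrow> (\<forall>k\<le>n. real (num_peelings (set (drop k ps))) \<le> 9.78 ^ n / 2 ^ k / 500))"
proof (induction n rule: less_induct)
  case (less n)
  show ?case
  proof (cases "n < 3")
    case True
    \<comment> \<open>At most two points form no triple, so they may be placed on the horizontal
      axis.\<close>
    define ps :: "(real^2) list" where "ps = map (\<lambda>i. vector [real i, 0]) [0..<n]"
    have "no_three_collinear (set ps)"
      unfolding no_three_collinear_def
    proof (intro ballI impI notI)
      fix a b c assume "a \<in> set ps" "b \<in> set ps" "c \<in> set ps" "a \<noteq> b" "b \<noteq> c" "a \<noteq> c"
      then have "card {a, b, c} = 3" "{a, b, c} \<subseteq> set ps"
        by auto
      then have "3 \<le> length ps"
        by (metis List.finite_set card_length card_mono order_trans)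
      then show False
        using True by (simp add: ps_def)
    qed
    moreover have "x_sorted ps"
      by (auto simp: ps_def sorted_wrt_map intro: sorted_wrt_mono_rel[OF _ sorted_wrt_upt])
    moreover have "length ps = n"
      by (simp add: ps_def)
    ultimately show ?thesis
      using True by (intro exI[of _ ps]) simp
  next
    case False
    obtain l m r where n: "n = l + m + r" and small: "l < n" "m < n" "r < n"
      and le: "n \<le> 3 * l + 2" "n \<le> 3 * m + 2" "n \<le> 3 * r + 2"
    proof -
      define q where "q = n div 3"
      have "n = 3 * q \<or> n = 3 * q + 1 \<or> n = 3 * q + 2"
        unfolding q_def by presburger
      then show ?thesis
      proof (elim disjE)
        assume "n = 3 * q"
        then show ?thesis
          using False by (intro that[of q q q]) auto
      next
        assume "n = 3 * q + 1"
        then show ?thesis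
          using False by (intro that[of "q + 1" q q]) auto
      next
        assume "n = 3 * q + 2"
        then show ?thesis
          using False by (intro that[of "q + 1" "q + 1" q]) auto
      qed
    qed
    obtain X where X: "length X = l" "x_sorted X" "no_three_collinear (set X)"
      "5 \<le> l \<longrightarrow> (\<forall>k\<le>l. real (num_peelings (set (drop k X))) \<le> 9.78 ^ l / 2 ^ k / 500)"
      using less[OF small(1)] by blast
    obtain Y where Y: "length Y = m" "x_sorted Y" "no_three_collinear (set Y)"
      "5 \<le> m \<longrightarrow> (\<forall>k\<le>m. real (num_peelings (set (drop k Y))) \<le> 9.78 ^ m / 2 ^ k / 500)"
      using less[OF small(2)] by blast
    obtain Z where Z: "length Z = r" "x_sorted Z" "no_three_collinear (set Z)"
      "5 \<le> r \<longrightarrow> (\<forall>k\<le>r. real (num_peelings (set (drop k Z))) \<le> 9.78 ^ r / 2 ^ k / 500)"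
      using less[OF small(3)] by blast
    obtain F G H where P: "x_sorted (map F X @ map G Y @ rev (map H Z))"
        "no_three_collinear (set (map F X @ map G Y @ rev (map H Z)))"
      and num: "\<And>S. finite S \<Longrightarrow> num_peelings (F ` S) = num_peelings S"
        "\<And>S. finite S \<Longrightarrow> num_peelings (G ` S) = num_peelings S"
        "\<And>S. finite S \<Longrightarrow> num_peelings (H ` S) = num_peelings S"
      and trap: "\<And>A B C. suffix A (map F X) \<Longrightarrow> suffix B (map G Y) \<Longrightarrow> suffix C (map H Z) \<Longrightarrow>
        A \<noteq> [] \<Longrightarrow> B \<noteq> [] \<Longrightarrow> C \<noteq> [] \<Longrightarrow>
        hull_vertices (set A \<union> set B \<union> set C) \<subseteq> {hd A, hd B, hd C}"
      using exists_three_clusters[OF X(2) Y(2) Z(2) X(3) Y(3) Z(3)] by blast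
    define ps where "ps = map F X @ map G Y @ rev (map H Z)"
    have len: "length ps = n"
      by (simp add: ps_def X Y Z n)
    have dist: "distinct ps"
      unfolding ps_def by (rule x_sorted_distinct[OF P(1)])
    have "real (num_peelings (set (drop k ps))) \<le> 9.78 ^ n / 2 ^ k / 500" if "5 \<le> n" "k \<le> n" for k
    proof (cases "n \<le> 15")
      case True
      have "card (set (drop k ps)) = n - k"
        using dist len by (simp add: distinct_card)
      then have "real (num_peelings (set (drop k ps))) \<le> real (fact (n - k))"
        using num_peelings_le_fact[of "set (drop k ps)"] by (simp only: of_nat_le_iff List.finite_set)
      then show ?thesis
        using fact_diff_le[OF that(1) True that(2)] by linarith
    next
      case False
      \<comment> \<open>From \<open>16 \<le> n \<le> 3 * l + 2\<close>, and likewise for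
        \<open>m\<close> and \<open>r\<close>.\<close>
      then have ge: "5 \<le> l" "5 \<le> m" "5 \<le> r"
        using le by linarith+
      define c :: real where "c = 9.78"
      have c: "c \<ge> 4"
        by (simp add: c_def)
      have cl: "2 ^ n \<le> 4 * c ^ l" "2 ^ n \<le> 4 * c ^ m" "2 ^ n \<le> 4 * c ^ r"
        using le two_power_le_cluster_power by (simp_all add: c_def)
      \<comment> \<open>With \<open>j\<close> points gone, \<open>1 / 2 ^ j\<close> equals
        \<open>2 ^ length A / 2 ^ t\<close>, which is the form that
        \<open>num_peelings_three_le\<close> takes.\<close>
      have suf: "real (num_peelings (set A)) \<le> (c ^ t / 2 ^ t / 500) * 2 ^ length A"
        if asm: "suffix A (map K W)" "length W = t"
          "\<And>S. finite S \<Longrightarrow> num_peelings (K ` S) = num_peelings S"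
          "\<forall>k\<le>t. real (num_peelings (set (drop k W))) \<le> 9.78 ^ t / 2 ^ k / 500" for A K W t
      proof -
        obtain B where B: "map K W = B @ A"
          using asm(1) by (auto simp: suffix_def)
        define j where "j = length B"
        have A: "A = map K (drop j W)"
          using B by (simp add: j_def drop_map[symmetric])
        have t: "t = j + length A"
          using arg_cong[OF B, of length] asm(2) by (simp add: j_def)
        have "real (num_peelings (set A)) = real (num_peelings (set (drop j W)))"
          by (simp add: A asm(3))
        also have "\<dots> \<le> c ^ t / 2 ^ j / 500"
          using asm(4) t by (simp add: c_def)
        also have "\<dots> = (c ^ t / 2 ^ t / 500) * 2 ^ length A"
          by (simp add: t power_add field_simps)
        finally show ?thesis .
      qed
      have sX: "real (num_peelings (set A)) \<le> (c ^ l / 2 ^ l / 500) * 2 ^ length A"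
        if "suffix A (map F X)" for A
        using suf[OF that X(1) num(1)] X(4) ge(1) by blast
      have sY: "real (num_peelings (set A)) \<le> (c ^ m / 2 ^ m / 500) * 2 ^ length A"
        if "suffix A (map G Y)" for A
        using suf[OF that Y(1) num(2)] Y(4) ge(2) by blast
      have sZ: "real (num_peelings (set A)) \<le> (c ^ r / 2 ^ r / 500) * 2 ^ length A"
        if "suffix A (map H Z)" for A
        using suf[OF that Z(1) num(3)] Z(4) ge(3) by blast
      have cn: "c ^ n = c ^ l * c ^ m * c ^ r"
        by (simp add: n power_add)
      have pos: "c ^ t > 0" for t
        using c by simp
      have four: "(4::real) ^ i = 2 ^ i * 2 ^ i" for i
        by (simp flip: power_mult_distrib)
      have dist': "distinct (map F X @ map G Y @ map H Z)"
        using dist by (auto simp: ps_def)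
      \<comment> \<open>The cut after \<open>k\<close> points falls into the first, the second or
        the reversed third cluster.\<close>
      consider "k \<le> l" | j where "k = l + j" "j \<le> m" | "k \<ge> l + m"
        by (metis le_add_diff_inverse nat_le_linear nat_add_left_cancel_le)
      then have "real (num_peelings (set (drop k ps))) \<le> c ^ n / 2 ^ k / 500"
      proof cases
        case 1
        define i where "i = l - k"
        have l: "l = k + i"
          using 1 by (simp add: i_def)
        have "set (drop k ps) = set (drop k (map F X)) \<union> set (map G Y) \<union> set (map H Z)"
          using 1 X(1) by (auto simp: ps_def)
        moreover have "real (num_peelings (set (drop k (map F X)) \<union> set (map G Y) \<union> set (map H Z)))
            \<le> (c ^ l / 2 ^ l / 500) * (c ^ m / 2 ^ m / 500)
                  * 4 ^ (length (drop k (map F X)) + length (map G Y)) * 2 ^ length (map H Z)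
              + (c ^ l / 2 ^ l / 500) * (c ^ r / 2 ^ r / 500)
                  * 4 ^ (length (drop k (map F X)) + length (map H Z)) * 2 ^ length (map G Y)
              + (c ^ m / 2 ^ m / 500) * (c ^ r / 2 ^ r / 500)
                  * 4 ^ (length (map G Y) + length (map H Z)) * 2 ^ length (drop k (map F X))"
          by (rule num_peelings_three_le[OF dist'])
            (fact trap sX sY sZ suffix_drop suffix_order.refl)+
        ultimately have "real (num_peelings (set (drop k ps)))
            \<le> (c ^ l / 2 ^ l / 500) * (c ^ m / 2 ^ m / 500) * 4 ^ (i + m) * 2 ^ r
              + (c ^ l / 2 ^ l / 500) * (c ^ r / 2 ^ r / 500) * 4 ^ (i + r) * 2 ^ m
              + (c ^ m / 2 ^ m / 500) * (c ^ r / 2 ^ r / 500) * 4 ^ (m + r) * 2 ^ i"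
          by (simp only: length_drop length_map X(1) Y(1) Z(1) i_def)
        also have "\<dots> \<le> c ^ l * c ^ m * c ^ r / 2 ^ k / 500"
          using three_cluster_estimate[of "2 ^ k" "2 ^ i" "2 ^ m" "2 ^ r" "c ^ l" "c ^ m" "c ^ r"] pos cl
          by (simp add: n l four power_add mult_ac)
        finally show ?thesis
          by (simp only: cn)
      next
        case (2 j)
        define i where "i = m - j"
        have m: "m = j + i"
          using 2 by (simp add: i_def)
        have "real (num_peelings (set (drop k ps)))
            = real (num_peelings (set (drop j (map G Y)) \<union> set (map H Z)))"
          using 2 X(1) Y(1) by (simp add: ps_def)
        also have "\<dots> \<le> real (2 ^ (i + r) * num_peelings (set (drop j (map G Y))) * num_peelings (set (map H Z)))"
        proof -
          have "set (drop j (map G Y)) \<inter> set (map H Z) = {}" "distinct (drop j (map G Y))"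
            "distinct (map H Z)"
            using dist' set_drop_subset[of j "map G Y"] by (auto simp del: drop_map)
          then show ?thesis
            using num_peelings_Un_le[of "set (drop j (map G Y))" "set (map H Z)"]
            by (simp only: of_nat_le_iff distinct_card List.finite_set length_drop length_map Y(1) Z(1) i_def)
        qed
        also have "\<dots> = 2 ^ (i + r) *
            (real (num_peelings (set (drop j (map G Y)))) * real (num_peelings (set (map H Z))))"
          by simp
        also have "\<dots> \<le> 2 ^ (i + r) * ((c ^ m / 2 ^ m / 500 * 2 ^ i) * (c ^ r / 2 ^ r / 500 * 2 ^ r))"
          using sY[OF suffix_drop[of j]] sZ[OF suffix_order.refl] Y(1) Z(1) pos[of m] c
          by (intro mult_left_mono mult_mono) (auto simp: i_def)
        also have "\<dots> = 2 ^ i * 2 ^ r * (c ^ m * c ^ r) / 2 ^ j / 250000"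
          by (simp add: m power_add)
        also have "\<dots> \<le> c ^ l * c ^ m * c ^ r / 2 ^ k / 500"
        proof -
          \<comment> \<open>The two surviving clusters contribute 1 / 500 twice, and the spare 500
            exceeds the 4 in \<open>cl\<close>.\<close>
          have "2 ^ l * 2 ^ i * 2 ^ r \<le> (2::real) ^ n"
            by (simp add: n m power_add)
          then have "2 ^ l * 2 ^ i * 2 ^ r \<le> 500 * c ^ l"
            using cl(1) pos[of l] by linarith
          then have "2 ^ l * 2 ^ i * 2 ^ r * (c ^ m * c ^ r) \<le> 500 * c ^ l * (c ^ m * c ^ r)"
            using pos by (intro mult_right_mono) (auto simp: less_imp_le)
          then show ?thesis
            by (simp add: 2(1) power_add field_simps)
        qed
        finally show ?thesis
          by (simp only: cn)
      next
        case 3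
        \<comment> \<open>The reversed cluster loses points from the end opposite to its peeling
          order, where the suffix bounds say nothing, so the remainder is bounded by the whole
          cluster. The powers of 9.78 of the two vanished clusters pay for
          \<open>2 ^ k\<close>.\<close>
        have "set (drop k ps) \<subseteq> set (map H Z)"
          using 3 X(1) Y(1) set_drop_subset[of "k - (l + m)" "rev (map H Z)"] by (simp add: ps_def)
        then have "real (num_peelings (set (drop k ps))) \<le> real (num_peelings (set (map H Z)))"
          by (intro of_nat_mono num_peelings_mono) auto
        also have "\<dots> \<le> c ^ r / 500"
          using sZ[OF suffix_order.refl] Z(1) by simp
        also have "\<dots> \<le> c ^ l * c ^ m * c ^ r / 2 ^ k / 500"
        proof -
          have "2 ^ k \<le> (2::real) ^ n"
            using that by simp
          also have "\<dots> \<le> c ^ l * 4"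
            using cl(1) by simp
          also have "\<dots> \<le> c ^ l * c ^ m"
            using c ge self_le_power[of c m] pos[of l] by (intro mult_left_mono) auto
          finally have "2 ^ k * c ^ r \<le> c ^ l * c ^ m * c ^ r"
            using pos[of r] by (intro mult_right_mono) auto
          then show ?thesis
            by (simp add: field_simps)
        qed
        finally show ?thesis
          by (simp only: cn)
      qed
      then show ?thesis
        by (simp add: c_def)
    qed
    then show ?thesis
      using P len by (intro exI[of _ ps]) (auto simp: ps_def)
  qed
qed

theorem theorem1:
  fixes n :: nat
  assumes "n \<ge> 6"
  shows "real (min_peelings n) \<le> 9.78 ^ n / 500"
proof -
  obtain ps where ps: "length ps = n" "x_sorted ps" "no_three_collinear (set ps)"
    "real (num_peelings (set (drop 0 ps))) \<le> 9.78 ^ n / 2 ^ 0 / 500"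
    using exists_good_arrangement[of n] assms by fastforce
  have "min_peelings n \<le> num_peelings (set ps)"
    unfolding min_peelings_def
    using ps x_sorted_distinct[OF ps(2)] general_position_if_no_three_collinear[OF ps(3)]
    by (intro cInf_lower imageI) (auto simp: distinct_card)
  then have "real (min_peelings n) \<le> real (num_peelings (set ps))"
    by simp
  then show ?thesis
    using ps(4) by simp
qed

end
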